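(* Let $A=(a_{i,j})_{i,j\in I}$ be an indecomposable Cartan matrix of finite type with Weyl group $W$, and let $c$ be a Coxeter element of $W$. There is a unique assignment of a nonnegative integer $(\gamma\|\delta)_c$ to any pair of weights $\gamma,\delta\in\Pi(c)$ satisfying the following properties: (1) $(\omega_i\|\omega_j)_c=0$ for $i,j\in I$; (2) $(\omega_i\|\gamma)_c=[c^{-1}\gamma-\gamma:\alpha_i]$ for $i\in I$ and $\gamma\in\Pi(c)-\{\omega_j:j\in I\}$; (3) $(\tau_c\gamma\|\tau_c\delta)_c=(\gamma\|\delta)_c$ for $\gamma,\delta\in\Pi(c)$.
   Context: $\alpha_i$ are the simple roots, $\omega_i$ the fundamental weights ($\alpha_j=\sum_i a_{i,j}\omega_i$), and $W$ is generated by the simple reflections $s_i$, $s_i\alpha_j=\alpha_j-a_{i,j}\alpha_i$. A Coxeter element is a product of all simple reflections, each once, in some order. The involution $i\mapsto i^\star$ of $I$ is given by $\omega_{i^\star}=-w_\circ\omega_i$, with $w_\circ$ the longest element of $W$. Weights are ordered by $\gamma\ge\delta$ iff $\gamma-\delta$ is a nonnegative integer combination of simple roots; $h(i;c)$ is the (unique) positive integer with $\omega_i>c\omega_i>\cdots>c^{h(i;c)}\omega_i=-\omega_{i^\star}$. $\Pi(c)=\{c^m\omega_i:i\in I,\ 0\le m\le h(i;c)\}$. $\tau_c$ is the permutation of $\Pi(c)$ given by $\tau_c(c^{m-1}\omega_i)=c^m\omega_i$ for $1\le m\le h(i;c)$ and $\tau_c(-\omega_i)=\omega_i$. $[\gamma:\alpha_i]$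 is the coefficient of $\alpha_i$ in the expansion of $\gamma$ in the basis of simple roots. *)

theory Defs
  imports "HOL-Analysis.Analysis"
begin

definition cartan_matrix_finite_type :: "int ^ 'i ^ 'i \<Rightarrow> bool" where
  "cartan_matrix_finite_type A \<longleftrightarrow>
     (\<forall>i. A $ i $ i = 2) \<and>
     (\<forall>i j. i \<noteq> j \<longrightarrow> A $ i $ j \<le> 0) \<and>
     (\<exists>d :: 'i \<Rightarrow> real.
        (\<forall>i. 0 < d i) \<and>
        (\<forall>i j. d i * of_int (A $ i $ j) = d j * of_int (A $ j $ i)) \<and>
        (\<forall>x :: real ^ 'i. x \<noteq> 0 \<longrightarrow>
           0 < (\<Sum>i\<in>UNIV. \<Sum>j\<in>UNIV. d i * of_int (A $ i $ j) * x $ i * x $ j)))"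

definition indecomposable :: "int ^ 'i ^ 'i \<Rightarrow> bool" where
  "indecomposable A \<longleftrightarrow>
     \<not> (\<exists>J. J \<noteq> {} \<and> J \<noteq> UNIV \<and> (\<forall>i\<in>J. \<forall>j\<in>- J. A $ i $ j = 0 \<and> A $ j $ i = 0))"

text \<open>Weights are written in coordinates with respect to the fundamental weights, so that
  the fundamental weights are the standard basis vectors of \<^typ>\<open>real ^ 'i\<close> and the \<open>j\<close>-th
  simple root is the \<open>j\<close>-th column of the Cartan matrix.\<close>

definition fund_weight :: "'i \<Rightarrow> real ^ 'i" where
  "fund_weight i = axis i 1"

definition simple_root :: "int ^ 'i ^ 'i \<Rightarrow> 'i \<Rightarrow> real ^ 'i" where
  "simple_root A j = (\<Sum>i\<in>UNIV. of_int (A $ i $ j) *\<^sub>R fund_weight i)"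

text \<open>The linear map with \<open>s\<^sub>i \<alpha>\<^sub>j = \<alpha>\<^sub>j - a\<^sub>i\<^sub>j \<alpha>\<^sub>i\<close>; see the two lemmas below.\<close>

definition simple_reflection :: "int ^ 'i ^ 'i \<Rightarrow> 'i \<Rightarrow> real ^ 'i \<Rightarrow> real ^ 'i" where
  "simple_reflection A i \<gamma> = \<gamma> - (\<gamma> $ i) *\<^sub>R simple_root A i"

lemma linear_simple_reflection: "linear (simple_reflection A i)"
  by (rule linearI) (simp_all add: simple_reflection_def algebra_simps)

lemma simple_root_nth: "simple_root A j $ i = of_int (A $ i $ j)"
  by (simp add: simple_root_def fund_weight_def axis_def if_distrib cong: if_cong)

lemma simple_reflection_simple_root:
  "simple_reflection A i (simple_root A j) =
     simple_root A j - of_int (A $ i $ j) *\<^sub>R simple_root A i"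
  by (simp add: simple_reflection_def simple_root_nth)

definition root_coeff :: "int ^ 'i ^ 'i \<Rightarrow> real ^ 'i \<Rightarrow> 'i \<Rightarrow> real" where
  "root_coeff A \<gamma> i = representation (range (simple_root A)) \<gamma> (simple_root A i)"

definition weight_ge :: "int ^ 'i ^ 'i \<Rightarrow> real ^ 'i \<Rightarrow> real ^ 'i \<Rightarrow> bool" where
  "weight_ge A \<gamma> \<delta> \<longleftrightarrow> (\<exists>n :: 'i \<Rightarrow> nat. \<gamma> - \<delta> = (\<Sum>i\<in>UNIV. real (n i) *\<^sub>R simple_root A i))"

definition weight_gt :: "int ^ 'i ^ 'i \<Rightarrow> real ^ 'i \<Rightarrow> real ^ 'i \<Rightarrow> bool" where
  "weight_gt A \<gamma> \<delta> \<longleftrightarrow> weight_ge A \<gamma> \<delta> \<and> \<gamma> \<noteq> \<delta>"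

inductive_set weyl_group :: "int ^ 'i ^ 'i \<Rightarrow> (real ^ 'i \<Rightarrow> real ^ 'i) set"
  for A :: "int ^ 'i ^ 'i" where
  identity: "id \<in> weyl_group A"
| reflection: "simple_reflection A i \<in> weyl_group A"
| composition: "v \<in> weyl_group A \<Longrightarrow> w \<in> weyl_group A \<Longrightarrow> v \<circ> w \<in> weyl_group A"
| inverse: "w \<in> weyl_group A \<Longrightarrow> inv w \<in> weyl_group A"

definition reflection_product :: "int ^ 'i ^ 'i \<Rightarrow> 'i list \<Rightarrow> real ^ 'i \<Rightarrow> real ^ 'i" where
  "reflection_product A is = foldr (\<circ>) (map (simple_reflection A) is) id"

definition weyl_length :: "int ^ 'i ^ 'i \<Rightarrow> (real ^ 'i \<Rightarrow> real ^ 'i) \<Rightarrow> nat" where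
  "weyl_length A w = (LEAST n. \<exists>is. length is = n \<and> w = reflection_product A is)"

definition longest_element :: "int ^ 'i ^ 'i \<Rightarrow> real ^ 'i \<Rightarrow> real ^ 'i" where
  "longest_element A =
     (THE w. w \<in> weyl_group A \<and> (\<forall>v\<in>weyl_group A. weyl_length A v \<le> weyl_length A w))"

definition star :: "int ^ 'i ^ 'i \<Rightarrow> 'i \<Rightarrow> 'i" where
  "star A i = (THE j. fund_weight j = - longest_element A (fund_weight i))"

definition coxeter_element :: "int ^ 'i ^ 'i \<Rightarrow> (real ^ 'i \<Rightarrow> real ^ 'i) \<Rightarrow> bool" where
  "coxeter_element A c \<longleftrightarrow>
     (\<exists>is. distinct is \<and> set is = UNIV \<and> c = reflection_product A is)"

definition cox_height :: "int ^ 'i ^ 'i \<Rightarrow> (real ^ 'i \<Rightarrow> real ^ 'i) \<Rightarrow> 'i \<Rightarrow> nat" where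
  "cox_height A c i = (THE h. 0 < h \<and>
     (\<forall>m<h. weight_gt A ((c ^^ m) (fund_weight i)) ((c ^^ Suc m) (fund_weight i))) \<and>
     (c ^^ h) (fund_weight i) = - fund_weight (star A i))"

definition cox_weights :: "int ^ 'i ^ 'i \<Rightarrow> (real ^ 'i \<Rightarrow> real ^ 'i) \<Rightarrow> (real ^ 'i) set" where
  "cox_weights A c = {(c ^^ m) (fund_weight i) | m i. m \<le> cox_height A c i}"

text \<open>Only meaningful for arguments in \<^term>\<open>cox_weights A c\<close>.\<close>

definition tau :: "int ^ 'i ^ 'i \<Rightarrow> (real ^ 'i \<Rightarrow> real ^ 'i) \<Rightarrow> real ^ 'i \<Rightarrow> real ^ 'i" where
  "tau A c \<gamma> = (THE \<delta>.
     (\<exists>i m. 1 \<le> m \<and> m \<le> cox_height A c i \<and>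
        \<gamma> = (c ^^ (m - 1)) (fund_weight i) \<and> \<delta> = (c ^^ m) (fund_weight i)) \<or>
     (\<exists>i. \<gamma> = - fund_weight i \<and> \<delta> = fund_weight i))"

end

theory Submission
  imports Defs
begin

text \<open>Write \<open>\<beta>\<^sub>i = \<omega>\<^sub>i - c \<omega>\<^sub>i\<close> and let \<open>B\<close> be the invariant form with
  \<open>B \<omega>\<^sub>i x = d\<^sub>i [x : \<alpha>\<^sub>i]\<close>. Rotating by \<open>\<tau>\<^sub>c\<close> brings the first argument to a fundamental
  weight, so uniqueness is clear. For existence, let the value at \<open>(c\<^sup>a \<omega>\<^sub>i, c\<^sup>b \<omega>\<^sub>j)\<close> be
  \<open>[c\<^sup>b\<^sup>-\<^sup>a\<^sup>-\<^sup>1 \<beta>\<^sub>j : \<alpha>\<^sub>i]\<close> if \<open>a < b\<close>, zero if \<open>a = b\<close>, and otherwise such that \<open>d\<^sub>i\<close> times the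
  value is symmetric. Invariance needs an argument only where one of the weights is the last one
  \<open>- \<omega>\<^sub>i\<^sub>\<star>\<close> of its chain; there it follows from the invariance of \<open>B\<close>, together with the vanishing of
  certain coefficients that are nonnegative along the chain and whose sum is zero.

  The chains end at \<open>- \<omega>\<^sub>i\<^sub>\<star>\<close> because the first negative root among the \<open>c\<^sup>k \<beta>\<^sub>i\<close> is some
  \<open>- \<beta>\<^sub>j\<close>.\<close>

section \<open>Auxiliary facts on integer sums and integer vectors\<close>

text \<open>Off-diagonal terms come in equal pairs. This is the parity behind
  \<open>even_norm\<close>.\<close>

lemma even_sum_symmetric:
  fixes t :: "'a \<Rightarrow> 'a \<Rightarrow> int"
  assumes "finite F" "\<And>i j. t i j = t j i" "\<And>i. even (t i i)"
  shows "even (\<Sum>i\<in>F. \<Sum>j\<in>F. t i j)"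
  using assms(1)
proof induction
  case (insert a F)
  have "(\<Sum>i\<in>insert a F. \<Sum>j\<in>insert a F. t i j)
      = t a a + (\<Sum>j\<in>F. t a j) + (\<Sum>i\<in>F. t i a) + (\<Sum>i\<in>F. \<Sum>j\<in>F. t i j)"
    using insert by (simp add: sum.distrib)
  also have "(\<Sum>i\<in>F. t i a) = (\<Sum>j\<in>F. t a j)"
    using assms(2) by (rule sum.cong[OF refl])
  finally show ?case
    using insert.IH assms(3) by simp
qed simp

lemma finite_integer_vectors:
  "finite {x :: real ^ 'n. \<forall>i. x $ i \<in> \<int> \<and> \<bar>x $ i\<bar> \<le> M}"
proof -
  have fin: "finite {y :: real. y \<in> \<int> \<and> \<bar>y\<bar> \<le> M}" (is "finite ?S")
    using finite_abs_int_segment by auto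
  have "{x :: real ^ 'n. \<forall>i. x $ i \<in> \<int> \<and> \<bar>x $ i\<bar> \<le> M} \<subseteq> vec_lambda ` (UNIV \<rightarrow>\<^sub>E ?S)"
  proof
    fix x :: "real ^ 'n"
    assume "x \<in> {x. \<forall>i. x $ i \<in> \<int> \<and> \<bar>x $ i\<bar> \<le> M}"
    then have "($) x \<in> UNIV \<rightarrow>\<^sub>E ?S" by auto
    then have "vec_lambda (($) x) \<in> vec_lambda ` (UNIV \<rightarrow>\<^sub>E ?S)" by (rule imageI)
    then show "x \<in> vec_lambda ` (UNIV \<rightarrow>\<^sub>E ?S)" by simp
  qed
  moreover have "finite ((UNIV :: 'n set) \<rightarrow>\<^sub>E ?S)"
    using fin by (simp add: finite_PiE)
  ultimately show ?thesis
    by (meson finite_imageI finite_subset)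
qed

lemma Ints_ge_0_Nats: "x \<in> \<int> \<Longrightarrow> 0 \<le> x \<Longrightarrow> x \<in> \<nat>" for x :: real
  by (auto simp: Nats_altdef2)

section \<open>Root coordinates for a symmetrized Cartan matrix\<close>

locale finite_cartan =
  fixes A :: "int ^ 'i ^ 'i" and d :: "'i \<Rightarrow> real"
  assumes diag: "A $ i $ i = 2"
    and offdiag: "i \<noteq> j \<Longrightarrow> A $ i $ j \<le> 0"
    and d_pos: "0 < d i"
    and d_sym: "d i * of_int (A $ i $ j) = d j * of_int (A $ j $ i)"
    and pos_def: "x \<noteq> 0 \<Longrightarrow>
      0 < (\<Sum>i\<in>UNIV. \<Sum>j\<in>UNIV. d i * of_int (A $ i $ j) * x $ i * x $ j)"
begin

abbreviation "\<alpha> \<equiv> simple_root A"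
abbreviation "\<omega> \<equiv> fund_weight :: 'i \<Rightarrow> real ^ 'i"
abbreviation "s \<equiv> simple_reflection A"
abbreviation "rp \<equiv> reflection_product A"
abbreviation "rc \<equiv> root_coeff A"
abbreviation "W \<equiv> weyl_group A"

text \<open>The coordinates of the relation say that the Cartan matrix kills \<open>f\<close>, so
  the quadratic form of \<open>pos_def\<close> vanishes at \<open>f\<close>.\<close>

lemma sum_simple_root_eq_0:
  assumes "(\<Sum>i\<in>UNIV. f i *\<^sub>R \<alpha> i) = 0"
  shows "f i = 0"
proof -
  have "(\<Sum>j\<in>UNIV. of_int (A $ i $ j) * f j) = 0" for i
    using arg_cong[OF assms, of "\<lambda>v. v $ i"] by (simp add: simple_root_nth mult.commute)
  then have "(\<Sum>i\<in>UNIV. d i * f i * (\<Sum>j\<in>UNIV. of_int (A $ i $ j) * f j)) = 0"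
    by simp
  then have "(\<Sum>i\<in>UNIV. \<Sum>j\<in>UNIV. d i * of_int (A $ i $ j) * f i * f j) = 0"
    by (simp add: sum_distrib_left mult_ac)
  then have "(\<chi> i. f i) = 0"
    using pos_def[of "\<chi> i. f i"] by force
  then show ?thesis
    by (metis vec_lambda_beta zero_index)
qed

lemma inj_simple_root: "inj \<alpha>"
proof (rule injI, rule ccontr)
  fix i j assume eq: "\<alpha> i = \<alpha> j" and "i \<noteq> j"
  define f :: "'i \<Rightarrow> real" where "f = (\<lambda>k. (if k = i then 1 else 0) - (if k = j then 1 else 0))"
  have "(\<Sum>k\<in>UNIV. f k *\<^sub>R \<alpha> k) = 0"
    using eq by (simp add: f_def scaleR_left_diff_distrib sum_subtractf
        if_distrib[of "\<lambda>a. a *\<^sub>R _"] cong: if_cong)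
  then have "f i = 0" by (rule sum_simple_root_eq_0)
  with \<open>i \<noteq> j\<close> show False by (simp add: f_def)
qed

lemma independent_simple_roots: "independent (range \<alpha>)"
proof (rule independent_if_scalars_zero)
  fix f x assume "(\<Sum>x\<in>range \<alpha>. f x *\<^sub>R x) = 0" and x: "x \<in> range \<alpha>"
  then have "(\<Sum>i\<in>UNIV. f (\<alpha> i) *\<^sub>R \<alpha> i) = 0"
    by (simp add: sum.reindex inj_simple_root)
  then have "f (\<alpha> i) = 0" for i by (rule sum_simple_root_eq_0)
  then show "f x = 0" using x by auto
qed simp

lemma span_simple_roots: "span (range \<alpha>) = UNIV"
proof -
  have "card (range \<alpha>) = DIM(real ^ 'i)"
    by (simp add: card_image inj_simple_root)
  then show ?thesis
    using card_ge_dim_independent[OF subset_UNIV independent_simple_roots] by auto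
qed

lemma rc_add [simp]: "rc (x + y) i = rc x i + rc y i"
  and rc_diff [simp]: "rc (x - y) i = rc x i - rc y i"
  and rc_neg [simp]: "rc (- x) i = - rc x i"
  and rc_scale [simp]: "rc (a *\<^sub>R x) i = a * rc x i"
  and rc_zero [simp]: "rc 0 i = 0"
  using independent_simple_roots span_simple_roots
  by (simp_all add: root_coeff_def representation_add representation_diff representation_neg
      representation_scale representation_zero)

lemma rc_alpha: "rc (\<alpha> i) j = (if i = j then 1 else 0)"
  using independent_simple_roots
  by (simp add: root_coeff_def representation_basis inj_eq[OF inj_simple_root])

lemma rc_expand: "x = (\<Sum>i\<in>UNIV. rc x i *\<^sub>R \<alpha> i)"
proof -
  have "(\<Sum>b\<in>range \<alpha>. representation (range \<alpha>) x b *\<^sub>R b) = x"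
    using independent_simple_roots span_simple_roots by (intro sum_representation_eq) auto
  then show ?thesis
    by (simp add: sum.reindex inj_simple_root root_coeff_def)
qed

lemma rc_eqI: "(\<And>i. rc x i = rc y i) \<Longrightarrow> x = y"
  using rc_expand[of x] rc_expand[of y] by simp

lemma rc_sum: "rc (\<Sum>i\<in>F. f i) j = (\<Sum>i\<in>F. rc (f i) j)"
  by (induction F rule: infinite_finite_induct) auto

lemma rc_sum_alpha: "rc (\<Sum>i\<in>UNIV. f i *\<^sub>R \<alpha> i) j = f j"
  by (simp add: rc_sum rc_alpha if_distrib[of "\<lambda>a. _ * a"] cong: if_cong)

lemma nth_rc: "x $ i = (\<Sum>j\<in>UNIV. of_int (A $ i $ j) * rc x j)"
  using arg_cong[OF rc_expand[of x], of "\<lambda>v. v $ i"] by (simp add: simple_root_nth mult.commute)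

section \<open>The invariant bilinear form\<close>

text \<open>The first argument is read in simple roots and the second in fundamental weights, bases
  that are dual up to the factors \<open>d i\<close>. Symmetry thus becomes a lemma, resting on
  \<open>d_sym\<close>.\<close>

definition B :: "real ^ 'i \<Rightarrow> real ^ 'i \<Rightarrow> real" where
  "B x y = (\<Sum>i\<in>UNIV. d i * rc x i * y $ i)"

lemma B_rc: "B x y = (\<Sum>i\<in>UNIV. \<Sum>j\<in>UNIV. d i * of_int (A $ i $ j) * rc x i * rc y j)"
  by (simp add: B_def nth_rc[of y] sum_distrib_left mult_ac)

lemma B_sym: "B x y = B y x"
proof -
  have "B x y = (\<Sum>j\<in>UNIV. \<Sum>i\<in>UNIV. d i * of_int (A $ i $ j) * rc x i * rc y j)"
    unfolding B_rc by (rule sum.swap)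
  also have "\<dots> = B y x"
    unfolding B_rc by (intro sum.cong refl) (metis d_sym mult.assoc mult.commute)
  finally show ?thesis .
qed

lemma B_pos: "x \<noteq> 0 \<Longrightarrow> 0 < B x x"
proof -
  assume "x \<noteq> 0"
  then have "(\<chi> i. rc x i) \<noteq> 0"
    by (metis rc_eqI rc_zero vec_lambda_beta zero_index)
  then show ?thesis
    using pos_def[of "\<chi> i. rc x i"] by (simp add: B_rc)
qed

lemma B_add_left [simp]: "B (x + y) z = B x z + B y z"
  by (simp add: B_def distrib_left distrib_right sum.distrib)

lemma B_scale_left [simp]: "B (a *\<^sub>R x) z = a * B x z"
  by (simp add: B_def sum_distrib_left mult_ac)

lemma B_neg_left [simp]: "B (- x) z = - B x z"
  using B_scale_left[of "-1" x z] by simp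

lemma B_diff_left [simp]: "B (x - y) z = B x z - B y z"
  using B_add_left[of x "- y" z] by simp

lemma B_linear_right [simp]:
  "B z (x + y) = B z x + B z y" "B z (x - y) = B z x - B z y"
  "B z (- x) = - B z x" "B z (a *\<^sub>R x) = a * B z x"
  by (simp_all add: B_sym[of z])

lemma B_alpha [simp]: "B (\<alpha> i) x = d i * x $ i"
  by (simp add: B_def rc_alpha if_distrib[of "\<lambda>a. _ * a"] if_distrib[of "\<lambda>a. a * _"] cong: if_cong)

lemma B_omega [simp]: "B (\<omega> i) x = d i * rc x i"
  by (subst B_sym) (simp add: B_def fund_weight_def axis_def if_distrib[of "\<lambda>a. _ * a"] cong: if_cong)

lemma alpha_nth_same [simp]: "\<alpha> i $ i = 2"
  by (simp add: simple_root_nth diag)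

lemma B_s: "B (s i x) (s i y) = B x y"
  by (simp add: simple_reflection_def B_sym[of x "\<alpha> i"])

lemma s_s [simp]: "s i (s i x) = x"
  by (simp add: simple_reflection_def algebra_simps)

lemma s_alpha [simp]: "s i (\<alpha> i) = - \<alpha> i"
  by (simp add: simple_reflection_def scaleR_2)

lemma s_omega: "s i (\<omega> j) = (if i = j then \<omega> j - \<alpha> j else \<omega> j)"
  by (simp add: simple_reflection_def fund_weight_def axis_def)

section \<open>Words in the simple reflections\<close>

lemma rp_Nil [simp]: "rp [] = id"
  by (simp add: reflection_product_def)

lemma rp_Cons [simp]: "rp (i # is) = s i \<circ> rp is"
  by (simp add: reflection_product_def)

lemma rp_append: "rp (us @ vs) = rp us \<circ> rp vs"
  by (induction us) (simp_all add: comp_assoc)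

lemma linear_rp: "linear (rp is)"
proof (induction "is")
  case (Cons i "is")
  then show ?case
    unfolding rp_Cons by (rule linear_compose[OF _ linear_simple_reflection])
qed (simp add: linear_ident id_def)

lemma B_rp: "B (rp is x) (rp is y) = B x y"
  by (induction "is") (simp_all add: B_s)

lemma rp_rev_rp [simp]: "rp (rev is) (rp is x) = x"
  by (induction "is" arbitrary: x) (simp_all add: rp_append)

lemma rp_rp_rev [simp]: "rp is (rp (rev is) x) = x"
  using rp_rev_rp[of "rev is"] by simp

lemma inv_rp: "inv (rp is) = rp (rev is)"
  by (rule inv_unique_comp) auto

lemma inj_rp: "inj (rp is)"
  by (rule inj_on_inverseI[where g = "rp (rev is)"]) simp

lemma weyl_group_iff: "w \<in> W \<longleftrightarrow> (\<exists>is. w = rp is)"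
proof
  show "w \<in> W \<Longrightarrow> \<exists>is. w = rp is"
  proof (induction rule: weyl_group.induct)
    case identity show ?case by (metis rp_Nil)
  next
    case (reflection i) show ?case
      by (rule exI[of _ "[i]"]) simp
  next
    case (composition v w) then show ?case by (metis rp_append)
  next
    case (inverse w) then show ?case by (metis inv_rp)
  qed
  have "rp is \<in> W" for "is"
    proof (induction "is")
    case Nil
    show ?case unfolding rp_Nil by (rule weyl_group.identity)
  next
    case (Cons i "is")
    then show ?case
      unfolding rp_Cons by (intro weyl_group.composition weyl_group.reflection)
  qed
  then show "\<exists>is. w = rp is \<Longrightarrow> w \<in> W" by auto
qed

lemma rc_s: "j \<noteq> i \<Longrightarrow> rc (s i x) j = rc x j"
  by (simp add: simple_reflection_def rc_alpha)

lemma rc_rp: "j \<notin> set is \<Longrightarrow> rc (rp is x) j = rc x j"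
  by (induction "is") (auto simp: rc_s)

subsection \<open>Roots\<close>

abbreviation nonneg :: "real ^ 'i \<Rightarrow> bool" where
  "nonneg x \<equiv> \<forall>i. 0 \<le> rc x i"

text \<open>A condition that is easily seen to hold on the Weyl orbit of \<open>\<alpha> j\<close>. The second integrality
  condition says that the coroot \<open>\<beta> / d j\<close> lies in the lattice spanned by the \<open>\<alpha> i / d i\<close>.\<close>

definition is_root :: "'i \<Rightarrow> real ^ 'i \<Rightarrow> bool" where
  "is_root j \<beta> \<longleftrightarrow> B \<beta> \<beta> = 2 * d j \<and> (\<forall>i. rc \<beta> i \<in> \<int> \<and> rc \<beta> i * d i / d j \<in> \<int>)"

lemma d_nonzero [simp]: "d i \<noteq> 0"
  using d_pos[of i] by simp

lemma is_root_alpha: "is_root j (\<alpha> j)"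
  by (simp add: is_root_def rc_alpha)

lemma is_root_neg: "is_root j (- \<beta>) \<longleftrightarrow> is_root j \<beta>"
  by (simp add: is_root_def)

lemma is_root_s:
  assumes "is_root j \<beta>"
  shows "is_root j (s i \<beta>)"
proof -
  have int: "rc \<beta> l \<in> \<int>" "rc \<beta> l * d l / d j \<in> \<int>" for l
    using assms unfolding is_root_def by blast+
  have 1: "\<beta> $ i \<in> \<int>"
    unfolding nth_rc by (intro Ints_sum Ints_mult Ints_of_int int)
  \<comment> \<open>By \<open>d_sym\<close> this is the corresponding coordinate of the coroot,
    computed with the transposed Cartan matrix, so the second integrality condition makes it an
    integer.\<close>
  have "\<beta> $ i * d i / d j = (\<Sum>l\<in>UNIV. of_int (A $ l $ i) * (rc \<beta> l * d l / d j))"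
  proof -
    have "\<beta> $ i * d i = (\<Sum>l\<in>UNIV. d i * of_int (A $ i $ l) * rc \<beta> l)"
      by (simp add: nth_rc sum_distrib_left sum_distrib_right mult_ac)
    also have "\<dots> = (\<Sum>l\<in>UNIV. of_int (A $ l $ i) * (rc \<beta> l * d l))"
      by (simp only: d_sym[of i]) (simp add: mult_ac)
    finally show ?thesis
      by (simp add: sum_divide_distrib)
  qed
  then have 2: "\<beta> $ i * d i / d j \<in> \<int>"
    by (simp only:) (intro Ints_sum Ints_mult Ints_of_int int)
  have "rc (s i \<beta>) l \<in> \<int> \<and> rc (s i \<beta>) l * d l / d j \<in> \<int>" for l
  proof (cases "l = i")
    case True
    have "rc (s i \<beta>) i = rc \<beta> i - \<beta> $ i"
      by (simp add: simple_reflection_def rc_alpha)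
    then show ?thesis
      unfolding True using Ints_diff[OF int(1) 1, of i] Ints_diff[OF int(2) 2]
      by (simp add: left_diff_distrib diff_divide_distrib)
  next
    case False
    then show ?thesis unfolding rc_s[OF False] using int by blast
  qed
  with assms show ?thesis
    by (simp add: is_root_def B_s)
qed

lemma is_root_rp: "is_root j \<beta> \<Longrightarrow> is_root j (rp is \<beta>)"
  by (induction "is") (auto simp: is_root_s)

lemma is_root_nonzero: "is_root j \<beta> \<Longrightarrow> \<beta> \<noteq> 0"
  using B_alpha B_scale_left[of 0] by (auto simp: is_root_def)

text \<open>With integer coordinates \<open>p\<close> in the simple roots and \<open>m\<close> for
  \<open>x / d j\<close> in the simple coroots, \<open>B x x\<close> is \<open>d j\<close> times a
  sum of integers to which \<open>even_sum_symmetric\<close> applies.\<close>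

lemma even_norm:
  assumes "\<And>i. rc x i \<in> \<int>" "\<And>i. rc x i * d i / d j \<in> \<int>"
  shows "\<exists>k :: int. B x x = 2 * d j * k"
proof -
  obtain p where p: "rc x i = of_int (p i)" for i
    using assms(1) unfolding Ints_def image_iff by metis
  obtain m where m: "rc x i * d i / d j = of_int (m i)" for i
    using assms(2) unfolding Ints_def image_iff by metis
  have m': "of_int (m i) * d j = p i * d i" for i
    using m[of i] p[of i] by (simp add: field_simps)
  define t where "t i l = m i * A $ i $ l * p l" for i l
  have t: "d j * of_int (t i l) = d i * of_int (A $ i $ l) * rc x i * rc x l" for i l
    using m'[of i] by (simp add: t_def p mult_ac)
  have "t i l = t l i" for i l
  proof -
    have "d j * of_int (t i l) = d j * of_int (t l i)"
      unfolding t using d_sym[of i l] by simp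
    then show ?thesis by simp
  qed
  moreover have "even (t i i)" for i
    by (simp add: t_def diag)
  ultimately have "even (\<Sum>i\<in>UNIV. \<Sum>l\<in>UNIV. t i l)"
    by (intro even_sum_symmetric) auto
  then obtain k where "(\<Sum>i\<in>UNIV. \<Sum>l\<in>UNIV. t i l) = 2 * k" ..
  then have "d j * of_int (2 * k) = d j * of_int (\<Sum>i\<in>UNIV. \<Sum>l\<in>UNIV. t i l)"
    by simp
  also have "\<dots> = B x x"
    by (simp add: B_rc sum_distrib_left flip: t)
  finally have "B x x = 2 * d j * k" by simp
  then show ?thesis ..
qed

lemma norm_ge:
  assumes "\<And>i. rc x i \<in> \<int>" "\<And>i. rc x i * d i / d j \<in> \<int>" "x \<noteq> 0"
  shows "2 * d j \<le> B x x"
proof -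
  obtain k :: int where k: "B x x = 2 * d j * k"
    using even_norm assms by blast
  with B_pos[OF assms(3)] have "0 < k"
    using d_pos[of j] by (simp add: zero_less_mult_iff)
  then show ?thesis
    using k d_pos[of j] by simp
qed

text \<open>If \<open>\<beta> = p - q\<close> with \<open>p\<close>, \<open>q\<close> nonnegative of disjoint supports, then
  \<open>B p q \<le> 0\<close>, so \<open>2 * d j = B \<beta> \<beta> \<ge> B p p + B q q\<close>, and \<open>B p p\<close>, \<open>B q q\<close> are multiples
  of \<open>2 * d j\<close>.\<close>

lemma root_sign:
  assumes "is_root j \<beta>"
  shows "nonneg \<beta> \<or> nonneg (- \<beta>)"
proof -
  define p where "p = (\<Sum>i\<in>UNIV. max (rc \<beta> i) 0 *\<^sub>R \<alpha> i)"
  define q where "q = (\<Sum>i\<in>UNIV. max (- rc \<beta> i) 0 *\<^sub>R \<alpha> i)"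
  have rcp: "rc p i = max (rc \<beta> i) 0" and rcq: "rc q i = max (- rc \<beta> i) 0" for i
    by (simp_all add: p_def q_def rc_sum_alpha)
  have eq: "\<beta> = p - q"
    by (rule rc_eqI) (simp add: rcp rcq max_def)
  have "B p q \<le> 0"
    unfolding B_rc
  proof (intro sum_nonpos)
    fix i l
    show "d i * of_int (A $ i $ l) * rc p i * rc q l \<le> 0"
    proof (cases "i = l")
      case False
      then have "d i * of_int (A $ i $ l) \<le> 0"
        using offdiag[of i l] d_pos[of i] by (simp add: mult_le_0_iff)
      moreover have "0 \<le> rc p i * rc q l"
        by (simp add: rcp rcq)
      ultimately show ?thesis
        by (simp add: mult.assoc[of _ "rc p i"] mult_nonpos_nonneg)
    qed (simp add: rcp rcq max_def)
  qed
  moreover have "B \<beta> \<beta> = B p p - 2 * B p q + B q q"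
    by (simp add: eq B_sym[of q p])
  ultimately have le: "B p p + B q q \<le> 2 * d j"
    using assms by (simp add: is_root_def)
  have "rc p i \<in> \<int>" "rc p i * d i / d j \<in> \<int>" "rc q i \<in> \<int>" "rc q i * d i / d j \<in> \<int>" for i
    using assms by (auto simp: is_root_def rcp rcq max_def)
  then have "p \<noteq> 0 \<Longrightarrow> 2 * d j \<le> B p p" "q \<noteq> 0 \<Longrightarrow> 2 * d j \<le> B q q"
    using norm_ge by blast+
  with le d_pos[of j] have "p = 0 \<or> q = 0" by fastforce
  then show ?thesis
    using rcp rcq by (metis eq diff_zero diff_0 minus_minus max.cobounded2)
qed

lemma nonneg_antisym: "nonneg x \<Longrightarrow> nonneg (- x) \<Longrightarrow> x = 0"
  by (rule rc_eqI) (simp add: order_antisym)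

text \<open>Only the coefficient at \<alpha> \<open>i\<close> can change sign, so all others vanish
  and \<beta> is a multiple \<open>k\<close> of \<alpha> \<open>i\<close>. The norm and the coroot
  condition then give \<open>k * m = 1\<close> with integers \<open>k\<close> and
  \<open>m\<close>.\<close>

lemma root_made_negative_by_s:
  assumes "is_root j \<beta>" "nonneg \<beta>" "\<not> nonneg (s i \<beta>)"
  shows "\<beta> = \<alpha> i"
proof -
  have neg: "nonneg (- s i \<beta>)"
    using root_sign[OF is_root_s[OF assms(1)]] assms(3) by blast
  have "rc \<beta> l = 0" if "l \<noteq> i" for l
    using neg assms(2) rc_s[OF that, of \<beta>] by (metis neg_0_le_iff_le order_antisym rc_neg)
  then have eq: "\<beta> = rc \<beta> i *\<^sub>R \<alpha> i"
    by (intro rc_eqI) (auto simp: rc_alpha)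
  obtain k m :: int where k: "rc \<beta> i = k" and m: "rc \<beta> i * d i / d j = m"
    using assms(1) unfolding is_root_def Ints_def image_iff by metis
  have "B \<beta> \<beta> = k * (k * (2 * d i))"
    by (subst (1 2) eq) (simp add: k mult_ac)
  then have "k * (k * d i) = d j"
    using assms(1) by (simp add: is_root_def)
  moreover have "k * d i = m * d j"
    using m k by (simp add: field_simps)
  ultimately have "of_int (k * m) * d j = 1 * d j"
    by (simp add: mult.assoc)
  then have "k * m = 1"
    unfolding mult_cancel_right by (simp flip: of_int_mult)
  moreover have "0 \<le> k"
    using assms(2) k by (metis of_int_0_le_iff)
  ultimately have "k = 1"
    by (auto simp: zmult_eq_1_iff)
  with eq k show ?thesis by simp
qed

text \<open>At some letter of the word the root passes from positive to negative, and there
  \<open>root_made_negative_by_s\<close> applies.\<close>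

lemma root_made_negative:
  assumes "is_root j \<beta>" "nonneg \<beta>" "\<not> nonneg (rp is \<beta>)"
  shows "\<exists>us i vs. is = us @ i # vs \<and> rp vs \<beta> = \<alpha> i"
  using assms(3)
proof (induction "is")
  case (Cons i "is")
  show ?case
  proof (cases "nonneg (rp is \<beta>)")
    case True
    with Cons.prems have "rp is \<beta> = \<alpha> i"
      using root_made_negative_by_s[OF is_root_rp[OF assms(1)]] by simp
    then show ?thesis by (metis append_Nil)
  next
    case False
    then show ?thesis using Cons.IH by (metis append_Cons)
  qed
qed (use assms(2) in simp)

subsection \<open>Length and the longest element\<close>

text \<open>The exchange condition: as \<open>rp vs\<close> carries \<alpha> \<open>k\<close> to
  \<alpha> \<open>i\<close>, it conjugates \<open>s k\<close> into \<open>s i\<close>, which cancels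
  the letter \<open>i\<close>.\<close>

lemma deletion:
  assumes "\<not> nonneg (rp is (\<alpha> k))"
  obtains us i vs where "is = us @ i # vs" "rp is \<circ> s k = rp (us @ vs)"
proof -
  have "nonneg (\<alpha> k)" by (simp add: rc_alpha)
  then obtain us i vs where "is": "is = us @ i # vs" and vs: "rp vs (\<alpha> k) = \<alpha> i"
    using root_made_negative[OF is_root_alpha _ assms] by blast
  \<comment> \<open>Equal norms give equal \<open>d\<close>, without which pairing with the two
    roots would not compare the coordinates \<open>i\<close> and \<open>k\<close>.\<close>
  have "B (\<alpha> i) (\<alpha> i) = B (\<alpha> k) (\<alpha> k)"
    by (metis vs B_rp)
  then have d: "d i = d k" by simp
  have "s i (rp vs x) = rp vs (s k x)" for x
  proof -
    have "d i * rp vs x $ i = B (rp vs (\<alpha> k)) (rp vs x)"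
      by (simp add: vs)
    also have "\<dots> = d i * x $ k"
      by (simp add: B_rp d)
    finally have "rp vs x $ i = x $ k" by simp
    then show ?thesis
      by (simp add: simple_reflection_def linear_diff[OF linear_rp] linear_scale[OF linear_rp] vs)
  qed
  then have "rp is (s k x) = rp (us @ vs) x" for x
    by (simp add: "is" rp_append flip: \<open>\<And>x. s i (rp vs x) = rp vs (s k x)\<close>)
  with "is" that show thesis
    by (metis comp_def ext)
qed

abbreviation "len \<equiv> weyl_length A"

lemma len_rp_le: "len (rp is) \<le> length is"
  unfolding weyl_length_def by (rule Least_le) auto

lemma reduced_word:
  assumes "w \<in> W"
  obtains "is" where "w = rp is" "len w = length is"
proof -
  have "\<exists>n is. length is = n \<and> w = rp is"
    using assms weyl_group_iff by auto
  from LeastI_ex[OF this] that show thesis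
    unfolding weyl_length_def by metis
qed

lemma rp_in_W [simp]: "rp is \<in> W"
  using weyl_group_iff by blast

lemma comp_s_in_W: "w \<in> W \<Longrightarrow> w \<circ> s k \<in> W"
  by (intro weyl_group.composition weyl_group.reflection)

lemma comp_s_s: "(w \<circ> s k) \<circ> s k = w"
  by auto

lemma len_comp_s_less:
  assumes "w \<in> W" "\<not> nonneg (w (\<alpha> k))"
  shows "len (w \<circ> s k) < len w"
proof -
  obtain "is" where "is": "w = rp is" "len w = length is"
    using reduced_word assms(1) .
  then obtain us i vs where "is = us @ i # vs" "rp is \<circ> s k = rp (us @ vs)"
    using deletion assms(2) by metis
  then show ?thesis
    using "is" len_rp_le[of "us @ vs"] by simp
qed

lemma is_root_W: "w \<in> W \<Longrightarrow> is_root j (w (\<alpha> j))"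
  using weyl_group_iff is_root_alpha is_root_rp by metis

lemma linear_W: "w \<in> W \<Longrightarrow> linear w"
  using weyl_group_iff linear_rp by metis

lemma B_W: "w \<in> W \<Longrightarrow> B (w x) (w y) = B x y"
  using weyl_group_iff B_rp by metis

lemma inj_W: "w \<in> W \<Longrightarrow> inj w"
  using weyl_group_iff inj_rp by metis

lemma inv_W [simp]: "w \<in> W \<Longrightarrow> inv w (w x) = x" "w \<in> W \<Longrightarrow> w (inv w x) = x"
  using weyl_group_iff inv_rp by auto

lemma W_funpow: "w \<in> W \<Longrightarrow> w ^^ n \<in> W"
  by (induction n) (simp_all add: weyl_group.identity weyl_group.composition)

lemma neg_W: "w \<in> W \<Longrightarrow> w (- x) = - w x"
  and diff_W: "w \<in> W \<Longrightarrow> w (x - y) = w x - w y"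
  by (simp_all add: linear_W linear_neg linear_diff)

lemma expand_W: "w \<in> W \<Longrightarrow> w x = (\<Sum>i\<in>UNIV. rc x i *\<^sub>R w (\<alpha> i))"
  by (subst rc_expand[of x]) (simp add: linear_W linear_sum linear_scale)

lemma nonpos_W:
  assumes "w \<in> W" "\<And>i. nonneg (- w (\<alpha> i))" "nonneg x"
  shows "nonneg (- w x)"
  using assms by (simp add: expand_W[of w x] rc_sum sum_nonpos mult_nonneg_nonpos)

lemma len_comp_s_greater:
  assumes "w \<in> W" "nonneg (w (\<alpha> k))"
  shows "len w < len (w \<circ> s k)"
proof -
  have "w (\<alpha> k) \<noteq> 0"
    using is_root_W[OF assms(1)] is_root_nonzero by blast
  then have "\<not> nonneg ((w \<circ> s k) (\<alpha> k))"
    using nonneg_antisym assms by (auto simp: neg_W)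
  then show ?thesis
    using len_comp_s_less[OF comp_s_in_W[OF assms(1)]] comp_s_s by metis
qed

text \<open>The last letter of a reduced word will do, since removing it shortens
  \<open>w\<close>.\<close>

lemma exists_simple_root_made_negative:
  assumes "w \<in> W" "w \<noteq> id"
  shows "\<exists>k. \<not> nonneg (w (\<alpha> k))"
proof -
  obtain "is" where "is": "w = rp is" "len w = length is"
    using reduced_word assms(1) .
  with assms(2) have "is \<noteq> []" by auto
  then obtain us k where us: "is = us @ [k]"
    by (metis rev_exhaust)
  then have "w \<circ> s k = rp us"
    by (simp add: "is" rp_append comp_def)
  then have "len (w \<circ> s k) \<le> length us"
    using len_rp_le[of us] by metis
  also have "length us < len w"
    using "is"(2) by (simp add: us)
  finally have "len (w \<circ> s k) < len w" .
  then show ?thesis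
    using len_comp_s_greater[OF assms(1)] by (metis order_less_asym)
qed

section \<open>Finiteness of the Weyl group\<close>

text \<open>The orbit consists of integer vectors of constant norm. Positivity of \<open>B\<close>
  at \<open>x - \<alpha> l\<close> and \<open>x + \<alpha> l\<close> bounds the coordinate
  \<open>l\<close>, and \<open>M\<close> is a common bound for all \<open>l\<close>.\<close>

lemma finite_orbit: "finite ((\<lambda>w. w (\<omega> i)) ` W)"
proof -
  define M where "M = (\<Sum>l\<in>UNIV. (2 * d l + B (\<omega> i) (\<omega> i)) / (2 * d l))"
  have B0: "0 \<le> B x x" for x
    using B_pos[of x] by (cases "x = 0") (auto simp: B_def)
  have "w (\<omega> i) $ l \<in> \<int>" if w: "w \<in> W" for w l
  proof -
    obtain "is" where "w = rp is" using w weyl_group_iff by auto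
    moreover have "\<forall>l. rp is (\<omega> i) $ l \<in> \<int>"
      by (induction "is") (simp_all add: fund_weight_def axis_def simple_reflection_def simple_root_nth)
    ultimately show ?thesis by simp
  qed
  moreover have "\<bar>w (\<omega> i) $ l\<bar> \<le> M" if w: "w \<in> W" for w l
  proof -
    define x where "x = w (\<omega> i)"
    have x: "B x x = B (\<omega> i) (\<omega> i)"
      by (simp add: x_def B_W[OF w] del: B_omega)
    have "0 \<le> B (x - \<alpha> l) (x - \<alpha> l)" "0 \<le> B (x + \<alpha> l) (x + \<alpha> l)"
      by (rule B0)+
    then have "2 * d l * x $ l \<le> 2 * d l + B x x" "- (2 * d l * x $ l) \<le> 2 * d l + B x x"
      by (simp_all add: B_sym[of x "\<alpha> l"])
    then have "\<bar>2 * d l * x $ l\<bar> \<le> 2 * d l + B x x" by simp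
    then have "\<bar>x $ l\<bar> \<le> (2 * d l + B x x) / (2 * d l)"
      using d_pos[of l] by (simp add: abs_mult pos_le_divide_eq mult.commute)
    also have "\<dots> \<le> M"
      unfolding M_def x
    proof (rule member_le_sum)
      fix l show "0 \<le> (2 * d l + B (\<omega> i) (\<omega> i)) / (2 * d l)"
        using B0[of "\<omega> i"] d_pos[of l] by (simp del: B_omega)
    qed simp_all
    finally show ?thesis by (simp add: x_def)
  qed
  ultimately show ?thesis
    by (intro finite_subset[OF _ finite_integer_vectors[of M]]) auto
qed

text \<open>An element is determined by its values on the fundamental weights, each of which has a
  finite orbit.\<close>

lemma finite_W: "finite W"
proof -
  let ?S = "\<lambda>i. (\<lambda>w. w (\<omega> i)) ` W"
  have "inj_on (\<lambda>w i. w (\<omega> i)) W"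
  proof (rule inj_onI)
    fix v w assume v: "v \<in> W" and w: "w \<in> W" and eq: "(\<lambda>i. v (\<omega> i)) = (\<lambda>i. w (\<omega> i))"
    have expand: "u x = (\<Sum>i\<in>UNIV. x $ i *\<^sub>R u (\<omega> i))" if "u \<in> W" for u x
    proof -
      have "x = (\<Sum>i\<in>UNIV. x $ i *\<^sub>R \<omega> i)"
        using basis_expansion[of x] by (simp add: fund_weight_def scalar_mult_eq_scaleR)
      then have "u x = u (\<Sum>i\<in>UNIV. x $ i *\<^sub>R \<omega> i)" by simp
      then show ?thesis
        by (simp add: linear_W[OF that] linear_sum linear_scale)
    qed
    show "v = w"
    proof
      fix x
      have "v x = (\<Sum>i\<in>UNIV. x $ i *\<^sub>R v (\<omega> i))" by (rule expand[OF v])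
      also have "\<dots> = (\<Sum>i\<in>UNIV. x $ i *\<^sub>R w (\<omega> i))"
        using fun_cong[OF eq] by simp
      also have "\<dots> = w x" by (rule expand[OF w, symmetric])
      finally show "v x = w x" .
    qed
  qed
  moreover have "finite ((UNIV :: 'i set) \<rightarrow>\<^sub>E (\<Union>i. ?S i))"
    using finite_orbit by (intro finite_PiE) auto
  then have "finite ((\<lambda>w i. w (\<omega> i)) ` W)"
    by (rule finite_subset[rotated]) auto
  ultimately show ?thesis
    by (rule finite_imageD[rotated])
qed

lemma len_maximal_nonpos:
  assumes "w \<in> W" "\<forall>v\<in>W. len v \<le> len w"
  shows "nonneg (- w (\<alpha> k))"
proof -
  have "\<not> nonneg (w (\<alpha> k))"
    using assms len_comp_s_greater comp_s_in_W by (metis linorder_not_less)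
  then show ?thesis
    using root_sign is_root_W[OF assms(1)] by blast
qed

text \<open>Both elements reverse signs, so \<open>inv v \<circ> w\<close> keeps every simple root
  positive and must be the identity.\<close>

lemma W_eqI_nonpos:
  assumes v: "v \<in> W" "\<And>k. nonneg (- v (\<alpha> k))" and w: "w \<in> W" "\<And>k. nonneg (- w (\<alpha> k))"
  shows "v = w"
proof -
  let ?u = "inv v \<circ> w"
  have u: "?u \<in> W"
    using v w by (intro weyl_group.composition weyl_group.inverse)
  have "nonneg (?u (\<alpha> k))" for k
  proof (rule ccontr)
    assume "\<not> nonneg (?u (\<alpha> k))"
    then have "nonneg (- ?u (\<alpha> k))"
      using root_sign[OF is_root_W[OF u]] by blast
    from nonpos_W[OF v this] have "nonneg (w (\<alpha> k))"
      using v by (simp add: neg_W)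
    then have "w (\<alpha> k) = 0"
      using nonneg_antisym w by blast
    then show False
      using is_root_nonzero is_root_W[OF w(1)] by blast
  qed
  then have "?u = id"
    using exists_simple_root_made_negative[OF u] by blast
  then have "inv v (w x) = x" for x
    by (metis comp_def id_apply)
  then have "w x = v x" for x
    using inv_W(2)[OF v(1)] by metis
  then show ?thesis by auto
qed

lemma longest_element_props:
  "longest_element A \<in> W" "nonneg (- longest_element A (\<alpha> k))"
proof -
  let ?P = "\<lambda>w. w \<in> W \<and> (\<forall>v\<in>W. len v \<le> len w)"
  have "finite (len ` W)" "len ` W \<noteq> {}"
    using finite_W weyl_group.identity by auto
  then have "Max (len ` W) \<in> len ` W" "\<forall>v\<in>W. len v \<le> Max (len ` W)"
    by (simp_all add: Max_in)
  then obtain w where "?P w" by auto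
  moreover have "w = v" if "?P w" "?P v" for v w
    using W_eqI_nonpos[of w v] len_maximal_nonpos that by blast
  ultimately have "\<exists>!w. ?P w" by blast
  then have "?P (longest_element A)"
    unfolding longest_element_def by (rule theI')
  then show "longest_element A \<in> W" "nonneg (- longest_element A (\<alpha> k))"
    using len_maximal_nonpos by blast+
qed

section \<open>Dominance and the involution \<open>star\<close>\<close>

text \<open>Passing from \<open>w\<close> to a shorter \<open>w \<circ> s k\<close> changes the
  weight only for \<open>k = i\<close>, and then by the negative root
  \<open>w (\<alpha> i)\<close>.\<close>

lemma omega_minus_orbit_nonneg:
  assumes "w \<in> W"
  shows "nonneg (\<omega> i - w (\<omega> i))"
  using assms
proof (induction "len w" arbitrary: w rule: less_induct)
  case less
  show ?case
  proof (cases "w = id")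
    case False
    then obtain k where k: "\<not> nonneg (w (\<alpha> k))"
      using exists_simple_root_made_negative less.prems by blast
    then have neg: "nonneg (- w (\<alpha> k))"
      using root_sign is_root_W[OF less.prems] by blast
    have IH: "nonneg (\<omega> i - (w \<circ> s k) (\<omega> i))"
      using less.hyps[OF len_comp_s_less comp_s_in_W] k less.prems by blast
    have "(w \<circ> s k) (\<omega> i) = (if k = i then w (\<omega> i) - w (\<alpha> i) else w (\<omega> i))"
      using less.prems by (simp add: s_omega diff_W)
    with IH neg show ?thesis
      by (auto split: if_splits) (smt (verit))
  qed simp
qed

lemma orbit_fund_weight_unique:
  assumes "w \<in> W" "w (\<omega> i) = \<omega> j"
  shows "i = j"
proof -
  have "inv w (\<omega> j) = \<omega> i"
    using assms inv_W(1) by metis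
  then have "nonneg (\<omega> j - \<omega> i)"
    using omega_minus_orbit_nonneg[of "inv w" j] assms weyl_group.inverse by metis
  moreover have "nonneg (\<omega> i - \<omega> j)"
    using omega_minus_orbit_nonneg[of w i] assms by metis
  ultimately have "\<omega> i = \<omega> j"
    using nonneg_antisym[of "\<omega> i - \<omega> j"] by simp
  then show ?thesis
    by (simp add: fund_weight_def axis_eq_axis)
qed

text \<open>Dominance bounds \<open>longest_element A (\<omega> i)\<close> from below by
  \<open>- \<omega> j\<close>. Since the longest element reverses signs, applying it to a second
  instance of dominance bounds it from above. So \<open>star\<close> can be read off any suitable
  Weyl group element, later a power of \<open>c\<close>.\<close>

lemma star_eqI:
  assumes w: "w \<in> W" "w (\<omega> i) = - \<omega> j"
  shows "star A i = j"
proof -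
  let ?w0 = "longest_element A"
  note w0 = longest_element_props
  have iW: "inv w \<in> W" "inv ?w0 \<in> W"
    using w w0(1) by (auto intro: weyl_group.inverse)
  have "\<omega> i = - inv w (\<omega> j)"
    using w inv_W(1) neg_W iW by metis
  then have "?w0 (\<omega> i) = - (?w0 \<circ> inv w) (\<omega> j)"
    using w0 by (simp add: neg_W)
  then have 1: "nonneg (?w0 (\<omega> i) + \<omega> j)"
    using omega_minus_orbit_nonneg[OF weyl_group.composition[OF w0(1) iW(1)], of j] by simp
  have "nonneg (\<omega> i - (inv ?w0 \<circ> w) (\<omega> i))"
    using w iW by (intro omega_minus_orbit_nonneg weyl_group.composition)
  from nonpos_W[OF w0 this] have "nonneg (- (?w0 (\<omega> i) + \<omega> j))"
    using w w0(1) by (simp add: diff_W)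
  with 1 have "?w0 (\<omega> i) + \<omega> j = 0"
    by (rule nonneg_antisym)
  then have "\<omega> j = - ?w0 (\<omega> i)"
    by (simp add: eq_neg_iff_add_eq_0 add.commute)
  then show ?thesis
    unfolding star_def by (metis (mono_tags) the_equality fund_weight_def axis_eq_axis zero_neq_one)
qed

text \<open>The height of a root, extended linearly; its strict decrease along a chain separates the
  weights of the chain.\<close>

definition ht :: "real ^ 'i \<Rightarrow> real" where
  "ht x = (\<Sum>i\<in>UNIV. rc x i)"

lemma ht_pos:
  assumes "nonneg x" "x \<noteq> 0"
  shows "0 < ht x"
proof -
  obtain i where "rc x i \<noteq> 0"
    using assms(2) rc_eqI[of x 0] by auto
  then show ?thesis
    unfolding ht_def using assms(1) by (intro sum_pos2[of _ i]) (auto simp: order_less_le)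
qed

lemma ht_diff: "ht (x - y) = ht x - ht y"
  by (simp add: ht_def sum_subtractf)

lemma weight_ge_iff: "weight_ge A x y \<longleftrightarrow> (\<forall>i. rc (x - y) i \<in> \<nat>)"
proof
  assume "weight_ge A x y"
  then obtain n :: "'i \<Rightarrow> nat" where "x - y = (\<Sum>i\<in>UNIV. real (n i) *\<^sub>R \<alpha> i)"
    unfolding weight_ge_def by blast
  then show "\<forall>i. rc (x - y) i \<in> \<nat>"
    by (simp only: rc_sum_alpha) simp
next
  assume "\<forall>i. rc (x - y) i \<in> \<nat>"
  then have "real (nat \<lfloor>rc (x - y) i\<rfloor>) = rc (x - y) i" for i
    by (metis Nats_cases floor_of_nat nat_int)
  then show "weight_ge A x y"
    unfolding weight_ge_def
    by (intro exI[of _ "\<lambda>i. nat \<lfloor>rc (x - y) i\<rfloor>"]) (simp only: flip: rc_expand)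
qed

lemma weight_gt_nonneg: "weight_gt A x y \<Longrightarrow> nonneg (x - y)"
  unfolding weight_gt_def weight_ge_iff by (metis Nats_cases of_nat_0_le_iff)

lemma weight_gt_ht: "weight_gt A x y \<Longrightarrow> ht y < ht x"
  using ht_pos[OF weight_gt_nonneg] by (fastforce simp: weight_gt_def ht_diff)

lemma root_diff_weight_gt: "is_root j (x - y) \<Longrightarrow> nonneg (x - y) \<Longrightarrow> weight_gt A x y"
  using is_root_nonzero[of j "x - y"]
  by (auto simp: weight_gt_def weight_ge_iff is_root_def simp del: rc_diff intro!: Ints_ge_0_Nats)

lemma rp_omega: "i \<notin> set is \<Longrightarrow> rp is (\<omega> i) = \<omega> i"
  by (induction "is") (auto simp: s_omega)

end

subsection \<open>Coxeter elements\<close>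

locale finite_cartan_coxeter = finite_cartan A d
  for A :: "int ^ 'i ^ 'i" and d :: "'i \<Rightarrow> real" +
  fixes c :: "real ^ 'i \<Rightarrow> real ^ 'i" and cs :: "'i list"
  assumes distinct_cs: "distinct cs"
    and set_cs: "set cs = UNIV"
    and c_eq: "c = rp cs"
begin

abbreviation "hh \<equiv> cox_height A c"
abbreviation "wt a i \<equiv> (c ^^ a) (\<omega> i)"

lemma c_in_W: "c \<in> W"
  by (simp add: c_eq)

lemma wt_in_W: "c ^^ a \<in> W"
  by (rule W_funpow[OF c_in_W])

text \<open>Each letter occurs once, so only \<open>s i\<close> can alter the coefficient at
  \<alpha> \<open>i\<close>. For a fixed vector each letter therefore acts trivially, in turn from
  the left, and all coordinates vanish.\<close>

lemma c_fixed_point: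
  assumes "c v = v"
  shows "v = 0"
proof -
  have "\<forall>i\<in>set is. v $ i = 0" if "distinct is" "rp is v = v" for "is"
    using that
  proof (induction "is")
    case (Cons i "is")
    let ?u = "rp is v"
    have "rc (s i ?u) i = rc ?u i"
      using Cons.prems rc_rp[of i "is" v] by simp
    then have u: "?u $ i = 0"
      by (simp add: simple_reflection_def rc_alpha)
    then have "s i ?u = ?u"
      by (simp add: simple_reflection_def)
    then have "?u = v"
      using Cons.prems by simp
    with u Cons show ?case by simp
  qed simp
  from this[OF distinct_cs] assms show ?thesis
    by (simp add: c_eq set_cs vec_eq_iff)
qed

definition \<beta> :: "'i \<Rightarrow> real ^ 'i" where
  "\<beta> i = \<omega> i - c (\<omega> i)"

text \<open>Letters other than \<open>i\<close> fix \<omega> \<open>i\<close>, so only the prefix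
  \<open>us\<close> is left to act on the difference \<alpha> \<open>i\<close>.\<close>

lemma beta_eq:
  assumes "cs = us @ i # vs"
  shows "\<beta> i = rp us (\<alpha> i)" "i \<notin> set us"
proof -
  show i: "i \<notin> set us" using distinct_cs assms by auto
  have "i \<notin> set vs" using distinct_cs assms by auto
  then have "c (\<omega> i) = rp us (\<omega> i - \<alpha> i)"
    by (simp add: c_eq assms rp_append rp_omega s_omega)
  with i show "\<beta> i = rp us (\<alpha> i)"
    by (simp add: \<beta>_def linear_diff[OF linear_rp] rp_omega)
qed

lemma beta_root: "is_root i (\<beta> i)"
  and beta_nonneg: "nonneg (\<beta> i)"
proof -
  have "i \<in> set cs" by (simp add: set_cs)
  then obtain us vs where "cs = us @ i # vs"
    by (meson split_list)
  note b = beta_eq[OF this]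
  show r: "is_root i (\<beta> i)"
    by (simp add: b is_root_rp is_root_alpha)
  \<comment> \<open>The prefix does not contain \<open>i\<close>, so this coefficient is still that
    of \<alpha> \<open>i\<close>; it decides the sign of the root.\<close>
  have "rc (\<beta> i) i = 1"
    by (simp add: b rc_rp rc_alpha)
  with root_sign[OF r] show "nonneg (\<beta> i)"
    by (metis neg_0_le_iff_le not_one_le_zero rc_neg)
qed

lemma c_pow_beta: "(c ^^ k) (\<beta> i) = wt k i - wt (Suc k) i"
  by (simp add: \<beta>_def diff_W[OF wt_in_W] funpow_swap1)

lemma c_pow_beta_root: "is_root i ((c ^^ k) (\<beta> i))"
  using beta_root is_root_rp wt_in_W weyl_group_iff by metis

text \<open>Otherwise the heights would decrease forever along a finite orbit.\<close>

lemma exists_c_pow_beta_negative: "\<exists>k. \<not> nonneg ((c ^^ k) (\<beta> i))"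
proof (rule ccontr)
  assume "\<not> ?thesis"
  then have "ht (wt (Suc k) i) < ht (wt k i)" for k
    using ht_pos[of "(c ^^ k) (\<beta> i)"] is_root_nonzero[OF c_pow_beta_root]
    by (simp add: c_pow_beta ht_diff)
  then have "strict_mono (\<lambda>k. - ht (wt k i))"
    unfolding strict_mono_Suc_iff by simp
  then have "inj (\<lambda>k. - ht (wt k i))"
    by (rule strict_mono_imp_inj_on)
  then have "inj (\<lambda>k. wt k i)"
    unfolding inj_def by metis
  moreover have "finite (range (\<lambda>k. wt k i))"
    by (rule finite_subset[OF _ finite_orbit[of i]]) (use wt_in_W in auto)
  ultimately show False
    using range_inj_infinite by blast
qed

text \<open>The first negative root in the \<open>c\<close>-orbit of \<open>\<beta> i\<close> is \<open>- \<beta> j\<close> for some \<open>j\<close>,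
  because these are the only negative roots whose preimage under \<open>c\<close> is positive.
  Since \<open>c\<close> has no fixed vectors, \<open>\<beta> j\<close> determines \<open>\<omega> j\<close>.\<close>

lemma exists_height:
  "\<exists>h j. 0 < h \<and> (\<forall>k<h. nonneg ((c ^^ k) (\<beta> i))) \<and> wt h i = - \<omega> j \<and> d j = d i"
proof -
  define h where "h = (LEAST k. \<not> nonneg ((c ^^ k) (\<beta> i)))"
  have neg: "\<not> nonneg ((c ^^ h) (\<beta> i))"
    unfolding h_def by (rule LeastI_ex) (rule exists_c_pow_beta_negative)
  have pos: "nonneg ((c ^^ k) (\<beta> i))" if "k < h" for k
    using not_less_Least[of k] that unfolding h_def by blast
  have "h \<noteq> 0"
    using neg beta_nonneg by (metis eq_id_iff funpow_0)
  then obtain m where m: "h = Suc m"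
    using not0_implies_Suc by blast
  define x where "x = (c ^^ m) (\<beta> i)"
  have "is_root i x" "nonneg x" "\<not> nonneg (rp cs x)"
    using c_pow_beta_root pos[of m] neg by (simp_all add: x_def m flip: c_eq)
  then obtain us j vs where cs: "cs = us @ j # vs" and x: "rp vs x = \<alpha> j"
    using root_made_negative by blast
  have "c x = rp us (s j (rp vs x))"
    by (simp add: c_eq cs rp_append)
  also have "\<dots> = - \<beta> j"
    by (simp add: x beta_eq[OF cs] linear_neg[OF linear_rp])
  finally have "(c ^^ h) (\<beta> i) = - \<beta> j"
    by (simp add: m x_def)
  then have "wt h i - c (wt h i) = - (\<omega> j - c (\<omega> j))"
    unfolding c_pow_beta unfolding \<beta>_def by simp
  then have "c (wt h i) + c (\<omega> j) = wt h i + \<omega> j"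
    by (simp add: algebra_simps)
  then have "c (wt h i + \<omega> j) = wt h i + \<omega> j"
    by (simp only: linear_add[OF linear_W[OF c_in_W]])
  then have "wt h i = - \<omega> j"
    using c_fixed_point by (simp add: eq_neg_iff_add_eq_0)
  moreover have "d j = d i"
  proof -
    have "is_root i (\<beta> j)"
      using c_pow_beta_root[where k = h and i = i] \<open>(c ^^ h) (\<beta> i) = - \<beta> j\<close> is_root_neg by metis
    then show ?thesis
      using beta_root[of j] by (simp add: is_root_def)
  qed
  ultimately show ?thesis
    using \<open>h \<noteq> 0\<close> pos by blast
qed

text \<open>Two definite descriptions are evaluated here: \<open>star A i\<close> by
  \<open>star_eqI\<close>, and \<open>hh i\<close> because \<open>ht\<close> drops strictly, so two
  chains from \<omega> \<open>i\<close> with the same last weight have the same length.\<close>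

lemma height_props:
  "0 < hh i" "\<And>k. k < hh i \<Longrightarrow> weight_gt A (wt k i) (wt (Suc k) i)"
  "wt (hh i) i = - \<omega> (star A i)" "d (star A i) = d i"
proof -
  obtain h j where h: "0 < h" "\<forall>k<h. nonneg ((c ^^ k) (\<beta> i))" "wt h i = - \<omega> j" "d j = d i"
    using exists_height by blast
  have j: "star A i = j"
    using h(3) star_eqI wt_in_W by blast
  let ?P = "\<lambda>h. 0 < h \<and> (\<forall>m<h. weight_gt A (wt m i) (wt (Suc m) i)) \<and> wt h i = - \<omega> (star A i)"
  have "weight_gt A (wt k i) (wt (Suc k) i)" if "k < h" for k
    using root_diff_weight_gt c_pow_beta_root h(2) that unfolding c_pow_beta by metis
  with h j have P: "?P h" by blast
  have less: "ht (wt b i) < ht (wt a i)" if "?P n" "a < b" "b \<le> n" for a b n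
    using that(2,3)
  proof (induction b)
    case (Suc b)
    have step: "ht (wt (Suc b) i) < ht (wt b i)"
      using that(1) Suc.prems by (intro weight_gt_ht) simp
    show ?case
    proof (cases "a = b")
      case False
      then show ?thesis using Suc step by simp
    qed (use step in simp)
  qed simp
  have "n = h" if n: "?P n" for n
  proof -
    have "ht (wt n i) = ht (wt h i)"
      using n P by simp
    then have "\<not> h < n" "\<not> n < h"
      using less[OF n, of h n] less[OF P, of n h] by auto
    then show ?thesis by simp
  qed
  with P have hh: "hh i = h"
    unfolding cox_height_def by (intro the_equality)
  have P_hh: "?P (hh i)"
    unfolding hh by (rule P)
  show "0 < hh i" "wt (hh i) i = - \<omega> (star A i)"
    using P_hh by simp_all
  show "weight_gt A (wt k i) (wt (Suc k) i)" if "k < hh i" for k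
    using P_hh that by simp
  show "d (star A i) = d i" using h j by simp
qed

lemma c_pow_beta_nonneg: "k < hh i \<Longrightarrow> nonneg ((c ^^ k) (\<beta> i))"
  unfolding c_pow_beta by (intro weight_gt_nonneg height_props)

section \<open>Distinctness of the weights and the action of \<open>tau\<close>\<close>

lemma wt_shift:
  assumes "a \<le> b" "wt a i = wt b j"
  shows "\<omega> i = wt (b - a) j"
proof -
  have "(c ^^ a) (\<omega> i) = (c ^^ a) (wt (b - a) j)"
    using assms funpow_add[of a "b - a" c] by simp
  then show ?thesis
    by (rule injD[OF inj_W[OF wt_in_W]])
qed

lemma wt_0:
  assumes "k \<le> hh j" "\<omega> i = wt k j"
  shows "i = j \<and> k = 0"
proof -
  have "j = i"
    by (rule orbit_fund_weight_unique[OF wt_in_W]) (use assms in simp)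
  moreover have "ht (wt k j) < ht (\<omega> j)" if "0 < k" "k \<le> hh j" for k
    using that
  proof (induction k)
    case (Suc k)
    then have "ht (wt (Suc k) j) < ht (wt k j)"
      by (intro weight_gt_ht height_props) simp
    then show ?case using Suc by (cases "k = 0") auto
  qed simp
  ultimately show ?thesis
    using assms by (metis gr0I order_less_irrefl)
qed

text \<open>Cancelling the smaller power of \<open>c\<close> reduces to a fundamental weight. This
  makes \<open>index\<close> well defined.\<close>

lemma wt_unique:
  assumes "a \<le> hh i" "b \<le> hh j" "wt a i = wt b j"
  shows "a = b \<and> i = j"
proof (cases "a \<le> b")
  case True
  have "b - a \<le> hh j" using assms(2) by simp
  from wt_0[OF this wt_shift[OF True assms(3)]] True show ?thesis by simp
next
  case False
  then have "b \<le> a" "a - b \<le> hh i" using assms(1) by simp_all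
  from wt_0[OF this(2) wt_shift[OF this(1) assms(3)[symmetric]]] False show ?thesis by simp
qed

text \<open>Running the rest of the chain would send \<omega> \<open>l\<close> to the fundamental
  weight of \<open>star A i\<close>, so the weight would already be the last one. This keeps the two
  clauses of \<open>tau\<close> apart.\<close>

lemma wt_neq_neg_omega:
  assumes "a < hh i"
  shows "wt a i \<noteq> - \<omega> l"
proof
  assume l: "wt a i = - \<omega> l"
  have "(c ^^ (hh i - a)) (wt a i) = wt (hh i) i"
    using assms funpow_add[of "hh i - a" a c] by simp
  then have "(c ^^ (hh i - a)) (\<omega> l) = \<omega> (star A i)"
    by (simp add: l height_props neg_W[OF wt_in_W])
  then have "l = star A i"
    using orbit_fund_weight_unique wt_in_W by blast
  with l have "wt a i = wt (hh i) i"
    by (simp add: height_props)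
  with wt_unique[of a i "hh i" i] assms show False by simp
qed

lemma tau_wt:
  assumes "a < hh i"
  shows "tau A c (wt a i) = wt (Suc a) i"
  unfolding tau_def
proof (rule the_equality)
  show "(\<exists>j m. 1 \<le> m \<and> m \<le> hh j \<and> wt a i = wt (m - 1) j \<and> wt (Suc a) i = wt m j) \<or>
      (\<exists>j. wt a i = - \<omega> j \<and> wt (Suc a) i = \<omega> j)"
    by (rule disjI1, intro exI[of _ i] exI[of _ "Suc a"]) (use assms in simp)
next
  fix \<delta>
  assume "(\<exists>j m. 1 \<le> m \<and> m \<le> hh j \<and> wt a i = wt (m - 1) j \<and> \<delta> = wt m j) \<or>
      (\<exists>j. wt a i = - \<omega> j \<and> \<delta> = \<omega> j)"
  then obtain j m where m: "1 \<le> m" "m \<le> hh j" "wt a i = wt (m - 1) j" "\<delta> = wt m j"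
    using wt_neq_neg_omega[OF assms] by blast
  then have "a = m - 1 \<and> i = j"
    using assms by (intro wt_unique) auto
  with m show "\<delta> = wt (Suc a) i" by simp
qed

lemma tau_wt_last: "tau A c (wt (hh i) i) = \<omega> (star A i)"
  unfolding tau_def
proof (rule the_equality)
  show "(\<exists>j m. 1 \<le> m \<and> m \<le> hh j \<and> wt (hh i) i = wt (m - 1) j \<and> \<omega> (star A i) = wt m j) \<or>
      (\<exists>j. wt (hh i) i = - \<omega> j \<and> \<omega> (star A i) = \<omega> j)"
    using height_props(3) by blast
next
  fix \<delta>
  assume "(\<exists>j m. 1 \<le> m \<and> m \<le> hh j \<and> wt (hh i) i = wt (m - 1) j \<and> \<delta> = wt m j) \<or>
      (\<exists>j. wt (hh i) i = - \<omega> j \<and> \<delta> = \<omega> j)"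
  then show "\<delta> = \<omega> (star A i)"
  proof (elim disjE exE conjE)
    fix j m assume m: "1 \<le> m" "m \<le> hh j" "wt (hh i) i = wt (m - 1) j"
    then have "m - 1 < hh j" by simp
    from wt_neq_neg_omega[OF this] m(3) height_props(3)[of i] show ?thesis by metis
  qed (use height_props(3)[of i] in simp)
qed

subsection \<open>The compatibility degree\<close>

lemma B_wt_c_pow_beta: "B (wt (a + m) i) ((c ^^ a) (\<beta> j)) = B (wt m i) (\<beta> j)"
  by (simp add: funpow_add B_W[OF wt_in_W])

lemma rc_star:
  "d i * rc ((c ^^ b) (\<beta> j)) (star A i) = - B (wt (hh i) i) ((c ^^ b) (\<beta> j))"
  by (simp add: height_props(3,4))

text \<open>After \<open>c ^^ b\<close> is cancelled, invariance of \<open>B\<close> moves the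
  difference between the identity and \<open>c\<close> from \<omega> \<open>j\<close> to \<omega>
  \<open>i\<close>.\<close>

lemma rc_star_reverse:
  assumes "b < hh i"
  shows "d i * rc ((c ^^ b) (\<beta> j)) (star A i) = d j * rc ((c ^^ (hh i - b - 1)) (\<beta> i)) j"
proof -
  define m where "m = hh i - b - 1"
  have m: "hh i = b + Suc m"
    using assms by (simp add: m_def)
  have "B (wt (Suc m) i) (c (\<omega> j)) = B (wt m i) (\<omega> j)"
    using B_W[OF c_in_W] by simp
  then have "- B (wt (Suc m) i) (\<beta> j) = B (wt m i - wt (Suc m) i) (\<omega> j)"
    unfolding \<beta>_def B_linear_right B_diff_left by linarith
  also have "\<dots> = B (\<omega> j) ((c ^^ m) (\<beta> i))"
    unfolding c_pow_beta by (rule B_sym)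
  finally show ?thesis
    unfolding rc_star m B_wt_c_pow_beta by simp
qed

text \<open>Cancelling \<open>c ^^ hh i\<close> in \<open>rc_star\<close> shows that the two
  coefficients add up to zero. Both exponents lie below \<open>hh j\<close>, so neither coefficient
  is negative.\<close>

lemma rc_beyond_height:
  assumes "hh i \<le> b" "b < hh j"
  shows "rc ((c ^^ b) (\<beta> j)) (star A i) = 0" "rc ((c ^^ (b - hh i)) (\<beta> j)) i = 0"
proof -
  have "(c ^^ b) (\<beta> j) = (c ^^ hh i) ((c ^^ (b - hh i)) (\<beta> j))"
    using assms(1) funpow_add[of "hh i" "b - hh i" c] by simp
  then have "d i * rc ((c ^^ b) (\<beta> j)) (star A i) = - (d i * rc ((c ^^ (b - hh i)) (\<beta> j)) i)"
    unfolding rc_star by (simp add: B_W[OF wt_in_W])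
  then have "d i * (rc ((c ^^ b) (\<beta> j)) (star A i) + rc ((c ^^ (b - hh i)) (\<beta> j)) i) = 0"
    by (simp add: distrib_left)
  then have "rc ((c ^^ b) (\<beta> j)) (star A i) + rc ((c ^^ (b - hh i)) (\<beta> j)) i = 0"
    by simp
  moreover have "0 \<le> rc ((c ^^ b) (\<beta> j)) (star A i)" "0 \<le> rc ((c ^^ (b - hh i)) (\<beta> j)) i"
    using c_pow_beta_nonneg[of b j] c_pow_beta_nonneg[of "b - hh i" j] assms by simp_all
  ultimately show "rc ((c ^^ b) (\<beta> j)) (star A i) = 0" "rc ((c ^^ (b - hh i)) (\<beta> j)) i = 0"
    by linarith+
qed

text \<open>The pair \<open>(a, i)\<close> stands for the weight \<open>c\<^sup>a \<omega>\<^sub>i\<close>.\<close>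

fun degree :: "nat \<times> 'i \<Rightarrow> nat \<times> 'i \<Rightarrow> real" where
  "degree (a, i) (b, j) =
    (if a < b then rc ((c ^^ (b - a - 1)) (\<beta> j)) i
     else if b < a then d j / d i * rc ((c ^^ (a - b - 1)) (\<beta> i)) j
     else 0)"

fun tau_index :: "nat \<times> 'i \<Rightarrow> nat \<times> 'i" where
  "tau_index (a, i) = (if a < hh i then (Suc a, i) else (0, star A i))"

text \<open>This lets \<open>degree_next\<close> treat the end of the second chain like the end of
  the first.\<close>

lemma degree_sym: "d i * degree (a, i) (b, j) = d j * degree (b, j) (a, i)"
  by auto

text \<open>For \<open>b < a\<close> the factor \<open>d j / d i\<close> is harmless because
  \<open>is_root\<close> also records integrality of the coroot.\<close>

lemma degree_Nats:
  assumes "a \<le> hh i" "b \<le> hh j"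
  shows "degree (a, i) (b, j) \<in> \<nat>"
proof -
  have "rc ((c ^^ (b - a - 1)) (\<beta> j)) i \<in> \<nat>" if "a < b"
  proof (rule Ints_ge_0_Nats)
    show "rc ((c ^^ (b - a - 1)) (\<beta> j)) i \<in> \<int>"
      using c_pow_beta_root[of j] unfolding is_root_def by blast
    show "0 \<le> rc ((c ^^ (b - a - 1)) (\<beta> j)) i"
      using that assms c_pow_beta_nonneg[of "b - a - 1" j] by simp
  qed
  moreover have "d j / d i * rc ((c ^^ (a - b - 1)) (\<beta> i)) j \<in> \<nat>" if "b < a"
  proof (rule Ints_ge_0_Nats)
    have "rc ((c ^^ (a - b - 1)) (\<beta> i)) j * d j / d i \<in> \<int>"
      using c_pow_beta_root[of i] unfolding is_root_def by blast
    then show "d j / d i * rc ((c ^^ (a - b - 1)) (\<beta> i)) j \<in> \<int>"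
      by (simp add: mult.commute)
    show "0 \<le> d j / d i * rc ((c ^^ (a - b - 1)) (\<beta> i)) j"
      using that assms c_pow_beta_nonneg[of "a - b - 1" i] d_pos[of i] d_pos[of j] by simp
  qed
  ultimately show ?thesis by simp
qed

text \<open>For \<open>b < hh j\<close> and \<open>b < hh i\<close> this is the reversal
  \<open>rc_star_reverse\<close>; in all other cases both sides vanish.\<close>

lemma degree_next_last:
  assumes "b \<le> hh j"
  shows "degree (tau_index (hh i, i)) (tau_index (b, j)) = degree (hh i, i) (b, j)"
proof (cases "b < hh j")
  case True
  then have 1: "degree (tau_index (hh i, i)) (tau_index (b, j)) = rc ((c ^^ b) (\<beta> j)) (star A i)"
    by simp
  consider "b < hh i" | "b = hh i" | "hh i < b" by linarith
  then show ?thesis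
  proof cases
    case 1
    then show ?thesis
      using True rc_star_reverse[OF 1, of j] by (simp add: field_simps)
  next
    case 2
    then show ?thesis using True rc_beyond_height(1)[of i b j] by simp
  next
    case 3
    \<comment> \<open>The rotated pair needs \<open>rc_beyond_height\<close> at exponent
      \<open>b\<close>, the original pair at \<open>b - 1\<close>.\<close>
    then have "hh i \<le> b - 1" "b - 1 < hh j" "hh i \<le> b" using True by simp_all
    with 3 True show ?thesis
      using rc_beyond_height(1)[of i b j] rc_beyond_height(2)[of i "b - 1" j]
      by (simp add: diff_commute)
  qed
next
  case False
  with assms have b: "b = hh j" by simp
  \<comment> \<open>Stated for all \<open>i\<close> and \<open>j\<close>, because either chain may
    be the longer one.\<close>
  have "rc ((c ^^ (hh j - hh i - 1)) (\<beta> j)) i = 0" if "hh i < hh j" for i j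
    using rc_beyond_height(2)[of i "hh j - 1" j] that by (simp add: diff_commute)
  then show ?thesis by (simp add: b)
qed

text \<open>Before the ends both exponents grow by one, and \<open>degree\<close> sees only their
  difference.\<close>

lemma degree_next:
  assumes "a \<le> hh i" "b \<le> hh j"
  shows "degree (tau_index (a, i)) (tau_index (b, j)) = degree (a, i) (b, j)"
proof -
  consider "a < hh i" "b < hh j" | "a = hh i" | "b = hh j"
    using assms by linarith
  then show ?thesis
  proof cases
    case 1
    then show ?thesis by simp
  next
    case 2
    then show ?thesis using degree_next_last[OF assms(2)] by simp
  next
    case 3
    \<comment> \<open>Rotation preserves \<open>d\<close>, so \<open>degree_sym\<close> has the same
      factors before and after it.\<close>
    obtain a' i' where n: "tau_index (a, i) = (a', i')" and di: "d i' = d i"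
      by (cases "a < hh i") (auto simp: height_props)
    obtain b' j' where m: "tau_index (b, j) = (b', j')" and dj: "d j' = d j"
      by (cases "b < hh j") (auto simp: height_props)
    have "d i * degree (a', i') (b', j') = d j * degree (b', j') (a', i')"
      using degree_sym[of i' a' b' j'] by (simp only: di dj)
    also have "\<dots> = d j * degree (b, j) (a, i)"
      using degree_next_last[OF assms(1), of j] unfolding 3 [symmetric] n m by simp
    also have "\<dots> = d i * degree (a, i) (b, j)"
      by (rule degree_sym)
    finally show ?thesis
      unfolding n m by simp
  qed
qed

section \<open>Passage from index pairs to weights; uniqueness and existence\<close>

abbreviation "weights \<equiv> cox_weights A c"

definition index :: "real ^ 'i \<Rightarrow> nat \<times> 'i" where
  "index \<gamma> = (THE p. fst p \<le> hh (snd p) \<and> \<gamma> = wt (fst p) (snd p))"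

lemma index_wt: "a \<le> hh i \<Longrightarrow> index (wt a i) = (a, i)"
  unfolding index_def by (rule the_equality) (auto dest: wt_unique)

lemma in_cox_weights_iff: "\<gamma> \<in> weights \<longleftrightarrow> (\<exists>a i. a \<le> hh i \<and> \<gamma> = wt a i)"
  by (auto simp: cox_weights_def)

lemma wt_in_cox_weights: "a \<le> hh i \<Longrightarrow> wt a i \<in> weights"
  unfolding in_cox_weights_iff by blast

lemma omega_in_cox_weights: "\<omega> i \<in> weights"
  using wt_in_cox_weights[of 0 i] by simp

lemma index_omega: "index (\<omega> i) = (0, i)"
  using index_wt[of 0 i] by simp

lemma tau_in_cox_weights: "\<gamma> \<in> weights \<Longrightarrow> tau A c \<gamma> \<in> weights"
  and index_tau: "\<gamma> \<in> weights \<Longrightarrow> index (tau A c \<gamma>) = tau_index (index \<gamma>)"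
proof -
  assume "\<gamma> \<in> weights"
  then obtain a i where a: "a \<le> hh i" and \<gamma>: "\<gamma> = wt a i"
    unfolding in_cox_weights_iff by blast
  have "tau A c \<gamma> \<in> weights \<and> index (tau A c \<gamma>) = tau_index (index \<gamma>)"
  proof (cases "a < hh i")
    case True
    then show ?thesis
      unfolding \<gamma> tau_wt[OF True] index_wt[OF a]
      using index_wt[of "Suc a" i] wt_in_cox_weights[of "Suc a" i] by simp
  next
    case False
    with a have "a = hh i" by simp
    then show ?thesis
      by (simp only: \<gamma> tau_wt_last omega_in_cox_weights index_omega index_wt) simp
  qed
  then show "tau A c \<gamma> \<in> weights" "index (tau A c \<gamma>) = tau_index (index \<gamma>)" by blast+
qed

text \<open>The extensional function space prescribes the values off
  \<open>weights \<times> weights\<close>, so that a total function can be unique.\<close>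

definition compatible :: "((real ^ 'i) \<times> (real ^ 'i) \<Rightarrow> nat) \<Rightarrow> bool" where
  "compatible f \<longleftrightarrow> f \<in> weights \<times> weights \<rightarrow>\<^sub>E UNIV \<and>
    (\<forall>i j. f (\<omega> i, \<omega> j) = 0) \<and>
    (\<forall>i. \<forall>\<gamma> \<in> weights - range \<omega>. real (f (\<omega> i, \<gamma>)) = rc (inv c \<gamma> - \<gamma>) i) \<and>
    (\<forall>\<gamma> \<in> weights. \<forall>\<delta> \<in> weights. f (tau A c \<gamma>, tau A c \<delta>) = f (\<gamma>, \<delta>))"

lemma compatible_unique:
  assumes "compatible f" "compatible g"
  shows "f = g"
proof -
  have omega: "f (\<omega> i, \<delta>) = g (\<omega> i, \<delta>)" if "\<delta> \<in> weights" for i \<delta>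
  proof (cases "\<delta> \<in> range \<omega>")
    case True
    then show ?thesis using assms by (auto simp: compatible_def)
  next
    case False
    with that have "\<delta> \<in> weights - range \<omega>" by blast
    then have "real (f (\<omega> i, \<delta>)) = real (g (\<omega> i, \<delta>))"
      using assms unfolding compatible_def by metis
    then show ?thesis by simp
  qed
  have tau: "f (\<gamma>, \<delta>) = g (\<gamma>, \<delta>)"
    if "f (tau A c \<gamma>, tau A c \<delta>) = g (tau A c \<gamma>, tau A c \<delta>)" "\<gamma> \<in> weights" "\<delta> \<in> weights" for \<gamma> \<delta>
    using assms that unfolding compatible_def by metis
  have "f (wt a i, \<delta>) = g (wt a i, \<delta>)" if "a \<le> hh i" "\<delta> \<in> weights" for a i \<delta>
    using that
  \<comment> \<open>The induction counts the steps left to the end of the chain, where one more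
    rotation reaches a fundamental weight. The second weight is rotated along and so must
    vary.\<close>
  proof (induction "hh i - a" arbitrary: a \<delta>)
    case 0
    then have "a = hh i" by linarith
    then have "tau A c (wt a i) = \<omega> (star A i)"
      by (simp only: tau_wt_last)
    then have "f (tau A c (wt a i), tau A c \<delta>) = g (tau A c (wt a i), tau A c \<delta>)"
      by (simp only: omega[OF tau_in_cox_weights[OF 0(3)]])
    then show ?case
      by (rule tau[OF _ wt_in_cox_weights[OF 0(2)] 0(3)])
  next
    case (Suc k)
    then have a: "Suc a \<le> hh i" "k = hh i - Suc a" by linarith+
    have "f (tau A c (wt a i), tau A c \<delta>) = g (tau A c (wt a i), tau A c \<delta>)"
      unfolding tau_wt[OF a(1)[unfolded Suc_le_eq]]
      by (rule Suc.hyps(1)[OF a(2,1) tau_in_cox_weights[OF Suc.prems(2)]])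
    then show ?case
      by (rule tau[OF _ wt_in_cox_weights[OF Suc.prems(1)] Suc.prems(2)])
  qed
  then have "f (\<gamma>, \<delta>) = g (\<gamma>, \<delta>)" if "\<gamma> \<in> weights" "\<delta> \<in> weights" for \<gamma> \<delta>
    using that in_cox_weights_iff[of \<gamma>] by blast
  then have eq: "f p = g p" if "p \<in> weights \<times> weights" for p
    using that by blast
  have "f \<in> weights \<times> weights \<rightarrow>\<^sub>E UNIV" "g \<in> weights \<times> weights \<rightarrow>\<^sub>E UNIV"
    using assms by (simp_all add: compatible_def)
  then show ?thesis
    using eq by (rule PiE_ext)
qed

text \<open>The rounding converts the real-valued \<open>degree\<close> to \<open>nat\<close>; by
  \<open>degree_Nats\<close> it loses nothing.\<close>

lemma compatible_degree:
  "compatible (restrict (\<lambda>(\<gamma>, \<delta>). nat \<lfloor>degree (index \<gamma>) (index \<delta>)\<rfloor>) (weights \<times> weights))"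
  (is "compatible ?f")
  unfolding compatible_def
proof (intro conjI allI ballI)
  show "?f \<in> weights \<times> weights \<rightarrow>\<^sub>E UNIV" by simp
  show "?f (\<omega> i, \<omega> j) = 0" for i j
    by (simp add: omega_in_cox_weights index_omega)
next
  fix i \<gamma> assume "\<gamma> \<in> weights - range \<omega>"
  then have "\<gamma> \<in> weights" "\<gamma> \<notin> range \<omega>" by auto
  then obtain b j where b: "b \<le> hh j" and \<gamma>: "\<gamma> = wt b j"
    unfolding in_cox_weights_iff by blast
  with \<open>\<gamma> \<notin> range \<omega>\<close> obtain k where k: "b = Suc k"
    by (cases b) auto
  have deg: "degree (0, i) (b, j) = rc ((c ^^ k) (\<beta> j)) i"
    by (simp add: k)
  have "rc ((c ^^ k) (\<beta> j)) i \<in> \<nat>"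
    using degree_Nats[of 0 i b j] b unfolding deg by simp
  then have "real (nat \<lfloor>rc ((c ^^ k) (\<beta> j)) i\<rfloor>) = rc ((c ^^ k) (\<beta> j)) i"
    by (metis Nats_cases floor_of_nat nat_int)
  moreover have "?f (\<omega> i, \<gamma>) = nat \<lfloor>degree (0, i) (b, j)\<rfloor>"
    using \<open>\<gamma> \<in> weights\<close> index_wt[OF b] by (simp add: omega_in_cox_weights index_omega \<gamma> del: degree.simps)
  \<comment> \<open>Undoing one step of \<open>c\<close> is the source of the \<open>- 1\<close> in
    the exponents of \<open>degree\<close>.\<close>
  moreover have "inv c \<gamma> - \<gamma> = (c ^^ k) (\<beta> j)"
    unfolding c_pow_beta by (simp add: \<gamma> k c_in_W)
  ultimately show "real (?f (\<omega> i, \<gamma>)) = rc (inv c \<gamma> - \<gamma>) i"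
    by (simp only: deg)
next
  fix \<gamma> \<delta> assume "\<gamma> \<in> weights" "\<delta> \<in> weights"
  then obtain a i b j where p: "a \<le> hh i" "b \<le> hh j" "index \<gamma> = (a, i)" "index \<delta> = (b, j)"
    unfolding in_cox_weights_iff using index_wt by blast
  have "degree (index (tau A c \<gamma>)) (index (tau A c \<delta>)) = degree (index \<gamma>) (index \<delta>)"
    unfolding index_tau[OF \<open>\<gamma> \<in> weights\<close>] index_tau[OF \<open>\<delta> \<in> weights\<close>] p(3,4)
    by (rule degree_next[OF p(1,2)])
  then show "?f (tau A c \<gamma>, tau A c \<delta>) = ?f (\<gamma>, \<delta>)"
    using \<open>\<gamma> \<in> weights\<close> \<open>\<delta> \<in> weights\<close> tau_in_cox_weights by simp
qed

end

theorem proposition5p1: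
  fixes A :: "int ^ 'i ^ 'i" and c :: "real ^ 'i \<Rightarrow> real ^ 'i"
  assumes "cartan_matrix_finite_type A"
    and "indecomposable A"
    and "coxeter_element A c"
  shows "\<exists>!compat :: (real ^ 'i) \<times> (real ^ 'i) \<Rightarrow> nat.
    compat \<in> cox_weights A c \<times> cox_weights A c \<rightarrow>\<^sub>E UNIV \<and>
    (\<forall>i j. compat (fund_weight i, fund_weight j) = 0) \<and>
    (\<forall>i. \<forall>\<gamma> \<in> cox_weights A c - range fund_weight.
       real (compat (fund_weight i, \<gamma>)) = root_coeff A (inv c \<gamma> - \<gamma>) i) \<and>
    (\<forall>\<gamma> \<in> cox_weights A c. \<forall>\<delta> \<in> cox_weights A c.
       compat (tau A c \<gamma>, tau A c \<delta>) = compat (\<gamma>, \<delta>))"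
proof -
  obtain d where "finite_cartan A d"
    using assms(1) unfolding cartan_matrix_finite_type_def finite_cartan_def by blast
  moreover obtain cs where "distinct cs" "set cs = UNIV" "c = reflection_product A cs"
    using assms(3) unfolding coxeter_element_def by blast
  ultimately interpret finite_cartan_coxeter A d c cs
    by (simp add: finite_cartan_coxeter_def finite_cartan_coxeter_axioms_def)
  show ?thesis
    using compatible_degree compatible_unique unfolding compatible_def[symmetric] by blast
qed

end
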